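(* Let $(B,\tau,\prec)$ be a topological vector lattice and let $E:B\to\mathbb{R}\cup\{+\infty\}$ be a convex and submodular functional. Let $\varphi,\psi\in B$ with $\varphi\prec\psi$, and let $\bar u\in B$ be a minimizer of $E$ on the interval $[\varphi,\psi]=\{z\in B:\varphi\prec z\prec\psi\}$. Assume that either $\mathrm{dom}\,E\cap\mathrm{int}\,[\varphi,\psi]\neq\emptyset$, or there exists $u\in\mathrm{dom}\,E\cap[\varphi,\psi]$ at which $E$ is continuous. Then: (1) for every $w_1^*\in\partial E(\varphi)\cap B^*_\prec$ there exists $x_1^*\in\partial E(\bar u)\cap B^*_\prec$ such that $x_1^*\prec w_1^*\vee 0$; (2) for every $w_2^*\in\partial E(\psi)\cap B^*_\prec$ there exists $x_2^*\in\partial E(\bar u)\cap B^*_\prec$ such that $w_2^*\wedge 0\prec x_2^*$.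
   Context: A topological vector lattice $(B,\tau,\prec)$ is a Hausdorff locally convex real topological vector space $(B,\tau)$ with a partial order $\prec$ (a reflexive order, i.e. "less than or equal") making $B$ a lattice (any $x,y$ have a least upper bound $x\vee y$ and a greatest lower bound $x\wedge y$), compatible with the vector structure: $x\prec y$ implies $x+z\prec y+z$ for all $z\in B$ and $\lambda x\prec\lambda y$ for all real $\lambda\ge 0$. No compatibility between the topology and the order is assumed. The positive cone is $P=\{x\in B: 0\prec x\}$, so $x\prec y$ iff $y-x\in P$. $B^*$ is the topological dual of $(B,\tau)$, with pairing $\langle\cdot,\cdot\rangle$; $P^*=\{x^*\in B^*:\langle x^*,x\rangle\ge 0\ \forall x\in P\}$; on functionals, $x^*\prec y^*$ means $\langle y^*-x^*,v\rangle\ge 0$ for all $v\in P$. The topological lattice dual is $B^*_\prec:=P^*-P^*$, regarded as a vector lattice with operations given by the Riesz–Kantorovich formulae: for $x\in P$, $(l\vee m)(x)=\sup_{0\prec z\prec x}\{l(z)+m(x-z)\}$ and $(l\wedge m)(x)=\inf_{0\prec z\prec x}\{l(z)+m(x-z)\}$, extended linearly to $B=P-P$. For convex $E$, $\mathrm{dom}\,E=\{x:E(x)<\infty\}$. The subdifferential $\partial E(x_0)\subset B^*$ is empty if $x_0\notin\mathrm{dom}\,E$, and otherwise is the set of $x^*\in B^*$ with $\langle x^*,x-x_0\rangle\le E(x)-E(x_0)$ for all $x\in B$. $E$ is submodular if $E(x\wedge y)+E(x\vee y)\le E(x)+E(y)$ for all $x,y\in B$. $\mathrm{int}$ denotes the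 $\tau$-interior. *)

theory Defs
  imports "HOL-Analysis.Analysis" "HOL-Library.Lattice_Algebras"
begin

class locally_convex_space = real_vector + topological_ab_group_add + t2_space +
  assumes tendsto_scaleR_Pair:
      "LIM p (nhds a \<times>\<^sub>F nhds x). fst p *\<^sub>R snd p :> nhds (a *\<^sub>R x)"
    and locally_convex_0:
      "open U \<Longrightarrow> 0 \<in> U \<Longrightarrow>
        \<exists>V. open V \<and> 0 \<in> V \<and> V \<subseteq> U \<and>
            (\<forall>x\<in>V. \<forall>y\<in>V. \<forall>u\<ge>0. \<forall>v\<ge>0. u + v = 1 \<longrightarrow> u *\<^sub>R x + v *\<^sub>R y \<in> V)"

text \<open>No axiom relates the topology to the order.\<close>

class topological_vector_lattice =
  locally_convex_space + ordered_real_vector + lattice_ab_group_add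

definition positive_cone :: "'a::topological_vector_lattice set" where
  "positive_cone = {x. 0 \<le> x}"

text \<open>Functionals on \<open>'a\<close> are plain functions into the reals. Their order is
  \<open>dual_le\<close>, which tests on the positive cone only; the pointwise order and lattice
  operations of the function type are not the ones of the dual.\<close>

definition topological_dual :: "('a::topological_vector_lattice \<Rightarrow> real) set" where
  "topological_dual = {f. linear f \<and> continuous_on UNIV f}"

definition positive_dual :: "('a::topological_vector_lattice \<Rightarrow> real) set" where
  "positive_dual = {f \<in> topological_dual. \<forall>x\<in>positive_cone. 0 \<le> f x}"

definition lattice_dual :: "('a::topological_vector_lattice \<Rightarrow> real) set" where
  "lattice_dual = {(\<lambda>x. f x - g x) | f g. f \<in> positive_dual \<and> g \<in> positive_dual}"

definition dual_le ::
  "('a::topological_vector_lattice \<Rightarrow> real) \<Rightarrow> ('a \<Rightarrow> real) \<Rightarrow> bool" where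
  "dual_le f g \<longleftrightarrow> (\<forall>v\<in>positive_cone. 0 \<le> g v - f v)"

text \<open>Since \<open>x = pprt x - pprt (- x)\<close> with both parts positive, \<open>cone_extension h\<close> is the
  linear extension of \<open>h\<close> whenever \<open>h\<close> is additive and positively homogeneous on the
  positive cone.\<close>

definition cone_extension ::
  "('a::topological_vector_lattice \<Rightarrow> real) \<Rightarrow> 'a \<Rightarrow> real" where
  "cone_extension h x = h (pprt x) - h (pprt (- x))"

definition dual_sup ::
  "('a::topological_vector_lattice \<Rightarrow> real) \<Rightarrow> ('a \<Rightarrow> real) \<Rightarrow> 'a \<Rightarrow> real" where
  "dual_sup l m = cone_extension (\<lambda>x. SUP z\<in>{0..x}. l z + m (x - z))"

definition dual_inf ::
  "('a::topological_vector_lattice \<Rightarrow> real) \<Rightarrow> ('a \<Rightarrow> real) \<Rightarrow> 'a \<Rightarrow> real" where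
  "dual_inf l m = cone_extension (\<lambda>x. INF z\<in>{0..x}. l z + m (x - z))"

lemma dual_sup_on_cone:
  assumes "linear l" "linear m" "x \<in> positive_cone"
  shows "dual_sup l m x = (SUP z\<in>{0..x}. l z + m (x - z))"
  using assms
  by (simp add: dual_sup_def cone_extension_def positive_cone_def pprt_def sup_absorb1
      sup_absorb2 linear_0)

lemma dual_inf_on_cone:
  assumes "linear l" "linear m" "x \<in> positive_cone"
  shows "dual_inf l m x = (INF z\<in>{0..x}. l z + m (x - z))"
  using assms
  by (simp add: dual_inf_def cone_extension_def positive_cone_def pprt_def sup_absorb1
      sup_absorb2 linear_0)

text \<open>The real supremum and infimum in \<open>dual_sup\<close> and \<open>dual_inf\<close> range over bounded sets.\<close>

lemma lattice_dual_bdd: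
  assumes "l \<in> lattice_dual" "m \<in> lattice_dual"
  shows "bdd_above ((\<lambda>z. l z + m (x - z)) ` {0..x})"
    and "bdd_below ((\<lambda>z. l z + m (x - z)) ` {0..x})"
proof -
  have bound: "\<exists>c. \<forall>z\<in>{0..x}. \<bar>k z\<bar> \<le> c" if "k \<in> lattice_dual" for k :: "'a \<Rightarrow> real"
  proof -
    from that obtain f g where k: "k = (\<lambda>z. f z - g z)"
      and fg: "f \<in> positive_dual" "g \<in> positive_dual"
      by (auto simp: lattice_dual_def)
    have b: "0 \<le> h z \<and> h z \<le> h x"
      if h: "h \<in> positive_dual" and z: "z \<in> {0..x}" for h :: "'a \<Rightarrow> real" and z
    proof -
      from h have lin: "linear h" and pos: "\<And>y. 0 \<le> y \<Longrightarrow> 0 \<le> h y"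
        by (auto simp: positive_dual_def topological_dual_def positive_cone_def)
      show ?thesis
        using pos[of z] pos[of "x - z"] z linear_diff[OF lin, of x z] by auto
    qed
    have "\<bar>k z\<bar> \<le> f x + g x" if "z \<in> {0..x}" for z
      using b[OF fg(1) that] b[OF fg(2) that] by (auto simp: k)
    then show ?thesis by blast
  qed
  obtain c d where c: "\<And>z. z \<in> {0..x} \<Longrightarrow> \<bar>l z\<bar> \<le> c" and d: "\<And>z. z \<in> {0..x} \<Longrightarrow> \<bar>m z\<bar> \<le> d"
    using bound[OF assms(1)] bound[OF assms(2)] by blast
  have "\<bar>l z + m (x - z)\<bar> \<le> c + d" if "z \<in> {0..x}" for z
    using c[OF that] d[of "x - z"] that by (auto simp: diff_le_eq)
  then show "bdd_above ((\<lambda>z. l z + m (x - z)) ` {0..x})"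
    and "bdd_below ((\<lambda>z. l z + m (x - z)) ` {0..x})"
    by (auto intro!: bdd_aboveI2[where M = "c + d"] bdd_belowI2[where m = "- (c + d)"]
        simp: abs_le_iff) (smt (verit, best) atLeastAtMost_iff)+
qed

text \<open>The codomain \<open>\<real> \<union> {+\<infinity>}\<close> is rendered as \<open>ereal\<close> with the value \<open>-\<infinity>\<close> excluded by
  hypothesis, so no sum below has the form \<open>\<infinity> - \<infinity>\<close>; \<open>0 * \<infinity> = 0\<close> makes the cases
  \<open>u = 0\<close> and \<open>v = 0\<close> of convexity trivial.\<close>

definition effective_domain :: "('a \<Rightarrow> ereal) \<Rightarrow> 'a set" where
  "effective_domain E = {x. E x < \<infinity>}"

definition convex_functional :: "('a::real_vector \<Rightarrow> ereal) \<Rightarrow> bool" where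
  "convex_functional E \<longleftrightarrow>
    (\<forall>x y. \<forall>u\<ge>0. \<forall>v\<ge>0. u + v = 1 \<longrightarrow>
      E (u *\<^sub>R x + v *\<^sub>R y) \<le> ereal u * E x + ereal v * E y)"

definition submodular :: "('a::lattice \<Rightarrow> ereal) \<Rightarrow> bool" where
  "submodular E \<longleftrightarrow> (\<forall>x y. E (inf x y) + E (sup x y) \<le> E x + E y)"

definition subdifferential ::
  "('a::topological_vector_lattice \<Rightarrow> ereal) \<Rightarrow> 'a \<Rightarrow> ('a \<Rightarrow> real) set" where
  "subdifferential E x0 =
    {f \<in> topological_dual. x0 \<in> effective_domain E \<and>
      (\<forall>x. ereal (f (x - x0)) \<le> E x - E x0)}"

end

theory Submission
  imports Defs
begin

text \<open>Fix \<open>w\<close> in the subdifferential at \<open>\<phi>\<close>. Submodularity for \<open>y\<close> and \<open>\<phi>\<close>, together with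
  minimality of \<open>ubar\<close> at \<open>sup y \<phi>\<close>, gives \<open>E ubar \<le> E y + w (pprt (\<phi> - y))\<close> for all \<open>y \<le> \<psi>\<close>: the
  lower obstacle may be traded for a penalty. Both hypotheses on the domain of \<open>E\<close> allow one to
  separate the epigraph of \<open>E\<close> from the hypograph of minus the penalty by a continuous
  functional. It is a subgradient at \<open>ubar\<close>, and testing it on \<open>y = ubar - v\<close> with \<open>0 \<le> v\<close> bounds
  its value at \<open>v\<close> by every upper bound of \<open>w\<close> on \<open>{0..v}\<close>. The second claim follows by the
  reflection \<open>x \<mapsto> - x\<close>.\<close>

section \<open>The Hahn-Banach theorem for sublinear functionals\<close>

definition sublinear :: "('a::real_vector \<Rightarrow> real) \<Rightarrow> bool" where
  "sublinear p \<longleftrightarrow> (\<forall>x y. p (x + y) \<le> p x + p y) \<and> (\<forall>c>0. \<forall>x. p (c *\<^sub>R x) = c * p x)"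

text \<open>The bound for \<open>inverse c\<close> at \<open>c *\<^sub>R x\<close> is the reverse
  inequality, so one half of positive homogeneity suffices.\<close>

lemma sublinearI:
  assumes "\<And>x y. p (x + y) \<le> p x + p y" "\<And>c x. 0 < c \<Longrightarrow> p (c *\<^sub>R x) \<le> c * p x"
  shows "sublinear p"
proof -
  have "c * p x \<le> p (c *\<^sub>R x)" if "0 < c" for c x
    using assms(2)[of "inverse c" "c *\<^sub>R x"] that by (simp add: field_simps)
  then show ?thesis
    using assms by (force simp: sublinear_def intro: antisym)
qed

lemma sublinear_add: "sublinear p \<Longrightarrow> p (x + y) \<le> p x + p y"
  and sublinear_scale: "sublinear p \<Longrightarrow> 0 < c \<Longrightarrow> p (c *\<^sub>R x) = c * p x"
  by (auto simp: sublinear_def)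

lemma sublinear_zero: "sublinear p \<Longrightarrow> p 0 = 0"
  using sublinear_scale[of p 2 0] by simp

lemma sublinear_minus_ge: "sublinear p \<Longrightarrow> - p (- x) \<le> p x"
  using sublinear_add[of p x "- x"] sublinear_zero[of p] by simp

text \<open>Every member lies above \<open>- p (- x)\<close> at \<open>x\<close>, so the infima are
  finite. Of two members of a chain one lies below both, and its subadditivity carries over to the
  infimum.\<close>

lemma sublinear_chain_Inf:
  assumes "C \<noteq> {}" and chain: "\<And>q r. q \<in> C \<Longrightarrow> r \<in> C \<Longrightarrow> q \<le> r \<or> r \<le> q"
    and sub: "\<And>q. q \<in> C \<Longrightarrow> sublinear q \<and> q \<le> p"
  shows "sublinear (\<lambda>x. INF q\<in>C. q x)" and "\<And>q x. q \<in> C \<Longrightarrow> (INF q\<in>C. q x) \<le> q x"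
proof -
  have bdd: "bdd_below ((\<lambda>q. q x) ` C)" for x
  proof (rule bdd_belowI2)
    fix q assume "q \<in> C"
    then show "- p (- x) \<le> q x"
      using sub sublinear_minus_ge[of q x] by (smt (verit) le_funD)
  qed
  show low: "(INF q\<in>C. q x) \<le> q x" if "q \<in> C" for q x
    using bdd that by (rule cINF_lower)
  show "sublinear (\<lambda>x. INF q\<in>C. q x)"
  proof (rule sublinearI)
    fix x y
    have "(INF q\<in>C. q (x + y)) \<le> q x + r y" if qr: "q \<in> C" "r \<in> C" for q r
    proof -
      obtain s where s: "s \<in> C" "s \<le> q" "s \<le> r"
        using chain[OF qr] qr by blast
      then show ?thesis
        using low[OF s(1), of "x + y"] sub[OF s(1)] sublinear_add[of s x y]
          le_funD[OF s(2), of x] le_funD[OF s(3), of y] by linarith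
    qed
    then have "(INF q\<in>C. q (x + y)) - r y \<le> (INF q\<in>C. q x)" if "r \<in> C" for r
      using that assms(1) by (intro cINF_greatest) (auto simp: algebra_simps)
    then have "(INF q\<in>C. q (x + y)) - (INF q\<in>C. q x) \<le> (INF q\<in>C. q y)"
      using assms(1) by (intro cINF_greatest) (auto simp: algebra_simps)
    then show "(INF q\<in>C. q (x + y)) \<le> (INF q\<in>C. q x) + (INF q\<in>C. q y)"
      by simp
  next
    fix c :: real and x assume c: "0 < c"
    have "(INF q\<in>C. q (c *\<^sub>R x)) / c \<le> (INF q\<in>C. q x)"
    proof (rule cINF_greatest[OF assms(1)])
      fix q assume q: "q \<in> C"
      show "(INF q\<in>C. q (c *\<^sub>R x)) / c \<le> q x"
        using low[OF q, of "c *\<^sub>R x"] sublinear_scale[of q c x] sub[OF q] c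
        by (simp add: field_simps)
    qed
    then show "(INF q\<in>C. q (c *\<^sub>R x)) \<le> c * (INF q\<in>C. q x)"
      using c by (simp add: field_simps)
  qed
qed

text \<open>Zorn's lemma for the reversed pointwise order: a nonempty chain is bounded by its
  pointwise infimum, the empty chain by \<open>p\<close>.\<close>

lemma minimal_sublinear_below:
  assumes "sublinear p"
  obtains q where "sublinear q" "q \<le> p" "\<And>r. sublinear r \<Longrightarrow> r \<le> q \<Longrightarrow> r = q"
proof -
  let ?S = "{q. sublinear q \<and> q \<le> p}"
  let ?R = "relation_of (\<lambda>q r. r \<le> q) ?S"
  have "\<exists>q\<in>?S. \<forall>r\<in>?S. r \<le> q \<longrightarrow> r = q"
  proof (rule predicate_Zorn)
    show "partial_order_on ?S ?R"
      by (rule partial_order_on_relation_ofI) auto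
    fix C assume C: "C \<in> Chains ?R"
    show "\<exists>u\<in>?S. \<forall>q\<in>C. u \<le> q"
    proof (cases "C = {}")
      case True
      then show ?thesis using assms by auto
    next
      case False
      have ch: "q \<le> r \<or> r \<le> q" if "q \<in> C" "r \<in> C" for q r
        using C that by (auto simp: Chains_def relation_of_def)
      have sub: "sublinear q \<and> q \<le> p" if "q \<in> C" for q
        using C that by (auto simp: Chains_def relation_of_def)
      note inf = sublinear_chain_Inf[of C p, OF False ch sub]
      let ?u = "\<lambda>x. INF q\<in>C. q x"
      have low: "?u \<le> q" if "q \<in> C" for q
        using that inf(2) by (intro le_funI)
      then have "?u \<le> p"
        using False sub by (meson ex_in_conv order_trans)
      then have "?u \<in> ?S"
        using inf(1) by simp
      then show ?thesis
        using low by blast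
    qed
  qed
  then show ?thesis
    using that by (auto intro: order_trans)
qed

text \<open>A minimal sublinear \<open>q\<close> is unchanged when it is lowered along the ray through \<open>y\<close>; this
  forces \<open>q x + q y \<le> q (x + y)\<close>.\<close>

lemma minimal_sublinear_linear:
  assumes q: "sublinear q" and min: "\<And>r. sublinear r \<Longrightarrow> r \<le> q \<Longrightarrow> r = q"
  shows "linear q"
proof -
  have super: "q x + q y \<le> q (x + y)" for x y
  proof -
    define r where "r x = (INF t\<in>{0..}. q (x + t *\<^sub>R y) - t * q y)" for x
    have qt: "q (t *\<^sub>R y) = t * q y" if "0 \<le> t" for t
      using that sublinear_scale[OF q, of t y] sublinear_zero[OF q] by (cases "t = 0") auto
    have "- q (- x) \<le> q (x + t *\<^sub>R y) - t * q y" if "0 \<le> t" for x t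
      using sublinear_add[OF q, of "x + t *\<^sub>R y" "- x"] qt[OF that] by simp
    then have bdd: "bdd_below ((\<lambda>t. q (x + t *\<^sub>R y) - t * q y) ` {0..})" for x
      by (intro bdd_belowI2[of _ "- q (- x)"]) auto
    have low: "r x \<le> q (x + t *\<^sub>R y) - t * q y" if "0 \<le> t" for x t
      unfolding r_def using that by (intro cINF_lower[OF bdd]) auto
    have "sublinear r"
    proof (rule sublinearI)
      fix x z
      \<comment> \<open>The parameters \<open>t\<close> and \<open>s\<close> of the two infima are
        merged into \<open>t + s\<close>.\<close>
      have le: "r (x + z) \<le> (q (x + t *\<^sub>R y) - t * q y) + (q (z + s *\<^sub>R y) - s * q y)"
        if "0 \<le> t" "0 \<le> s" for t s
        using low[of "t + s" "x + z"] that
          sublinear_add[OF q, of "x + t *\<^sub>R y" "z + s *\<^sub>R y"]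
        by (simp add: algebra_simps)
      have "r (x + z) - (q (z + s *\<^sub>R y) - s * q y) \<le> r x" if "0 \<le> s" for s
        unfolding r_def[of x] using le[OF _ that]
        by (intro cINF_greatest) (auto simp: algebra_simps)
      then have "r (x + z) - r x \<le> r z"
        unfolding r_def[of z] by (intro cINF_greatest) (auto simp: algebra_simps)
      then show "r (x + z) \<le> r x + r z" by simp
    next
      fix c :: real and x assume c: "0 < c"
      have "r (c *\<^sub>R x) / c \<le> q (x + t *\<^sub>R y) - t * q y" if "0 \<le> t" for t
        using low[of "c * t" "c *\<^sub>R x"] sublinear_scale[OF q c, of "x + t *\<^sub>R y"] that c
        by (simp add: field_simps)
      then have "r (c *\<^sub>R x) / c \<le> r x"
        unfolding r_def[of x] by (intro cINF_greatest) auto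
      then show "r (c *\<^sub>R x) \<le> c * r x"
        using c by (simp add: field_simps)
    qed
    moreover have "r \<le> q"
      using low[of 0] by (auto simp: le_fun_def)
    ultimately have "r = q" by (rule min)
    \<comment> \<open>At \<open>t = 1\<close> the infimum, now equal to \<open>q x\<close>, is at
      most \<open>q (x + y) - q y\<close>.\<close>
    then show ?thesis
      using low[of 1 x] by simp
  qed
  have add: "q (x + y) = q x + q y" for x y
    using super sublinear_add[OF q] by (intro antisym)
  have neg: "q (- x) = - q x" for x
    using add[of x "- x"] sublinear_zero[OF q] by simp
  have "q (c *\<^sub>R x) = c *\<^sub>R q x" for c x
  proof (cases c "0::real" rule: linorder_cases)
    case less
    then show ?thesis
      using sublinear_scale[OF q, of "- c" x] neg[of "c *\<^sub>R x"] by simp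
  qed (use sublinear_scale[OF q] sublinear_zero[OF q] in auto)
  with add show ?thesis
    by (rule linearI)
qed

theorem hahn_banach_sublinear:
  assumes "sublinear p"
  obtains f where "linear f" "\<And>x. f x \<le> p x"
  using minimal_sublinear_below[OF assms] minimal_sublinear_linear
  by (metis le_funD)

section \<open>Separation of convex sets by a continuous linear functional\<close>

text \<open>The function \<open>p\<close> is the lower boundary of the cone generated by
  \<open>C\<close>. Absorption makes each \<open>R d\<close> nonempty, and nonnegativity over 0
  makes every negated element of \<open>R (- d)\<close> a lower bound of \<open>R d\<close>. Hence
  \<open>p\<close> is finite, convexity makes it sublinear, and Hahn-Banach yields \<open>f\<close>
  below it.\<close>

lemma linear_below_convex:
  fixes C :: "('a::real_vector \<times> real) set"
  assumes C: "convex C" and zero: "\<And>r. (0, r) \<in> C \<Longrightarrow> 0 \<le> r"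
    and absorb: "\<And>d. \<exists>t>0. \<exists>r. (t *\<^sub>R d, r) \<in> C"
  obtains f where "linear f" "\<And>d r. (d, r) \<in> C \<Longrightarrow> f d \<le> r"
proof -
  define R where "R d = {r / t |r t. 0 < t \<and> (t *\<^sub>R d, r) \<in> C}" for d
  define p where "p d = Inf (R d)" for d
  have ne: "R d \<noteq> {}" for d
    using absorb[of d] by (auto simp: R_def)
  have R_add: "a + b \<in> R (d + e)" if ab: "a \<in> R d" "b \<in> R e" for a b d e
  proof -
    obtain r t s u where a: "a = r / t" "0 < t" "(t *\<^sub>R d, r) \<in> C"
      and b: "b = s / u" "0 < u" "(u *\<^sub>R e, s) \<in> C"
      using ab by (auto simp: R_def)
    \<comment> \<open>The weights \<open>u / (t + u)\<close> and \<open>t / (t + u)\<close> bring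
      both points to the same multiple \<open>?k\<close> of \<open>d\<close> and \<open>e\<close>;
      dividing the height by \<open>?k\<close> then gives \<open>r / t + s / u\<close>.\<close>
    let ?k = "t * u / (t + u)"
    have "(u / (t + u)) *\<^sub>R (t *\<^sub>R d, r) + (t / (t + u)) *\<^sub>R (u *\<^sub>R e, s) \<in> C"
      using a b by (intro convexD[OF C]) (auto simp flip: add_divide_distrib)
    then have "(?k *\<^sub>R (d + e), (u * r + t * s) / (t + u)) \<in> C"
      by (simp add: scaleR_add_right add_divide_distrib mult.commute)
    moreover have "0 < t + u"
      using a b by simp
    then have "a + b = ((u * r + t * s) / (t + u)) / ?k" and "0 < ?k"
      using a b by (auto simp: add_frac_eq mult.commute)
    ultimately show ?thesis
      unfolding R_def by blast
  qed
  have "0 \<le> a" if "a \<in> R 0" for a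
    using that zero by (auto simp: R_def)
  then have "- b \<le> a" if "a \<in> R d" "b \<in> R (- d)" for a b d
    using R_add[OF that] by force
  then have bdd: "bdd_below (R d)" for d
    using ne[of "- d"] by (metis bdd_belowI ex_in_conv)
  have "sublinear p"
  proof (rule sublinearI)
    fix d e
    have "p (d + e) \<le> a + b" if "a \<in> R d" "b \<in> R e" for a b
      unfolding p_def using R_add[OF that] bdd by (rule cInf_lower)
    then have "p (d + e) - b \<le> p d" if "b \<in> R e" for b
      unfolding p_def[of d] using that ne by (intro cInf_greatest) (auto simp: algebra_simps)
    then have "p (d + e) - p d \<le> p e"
      unfolding p_def[of e] using ne by (intro cInf_greatest) (auto simp: algebra_simps)
    then show "p (d + e) \<le> p d + p e" by simp
  next
    fix c :: real and d assume c: "0 < c"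
    have "p (c *\<^sub>R d) / c \<le> a" if aR: "a \<in> R d" for a
    proof -
      obtain r t where a: "a = r / t" "0 < t" "(t *\<^sub>R d, r) \<in> C"
        using aR by (auto simp: R_def)
      have "r / (t / c) \<in> R (c *\<^sub>R d)"
        unfolding R_def using a c by (intro CollectI exI[of _ r] exI[of _ "t / c"]) auto
      then have "p (c *\<^sub>R d) \<le> r / (t / c)"
        unfolding p_def using bdd by (intro cInf_lower)
      also have "\<dots> = a * c"
        using a c by simp
      finally show ?thesis
        using c by (simp add: pos_divide_le_eq)
    qed
    then have "p (c *\<^sub>R d) / c \<le> p d"
      unfolding p_def[of d] using ne by (intro cInf_greatest)
    then show "p (c *\<^sub>R d) \<le> c * p d"
      using c by (simp add: field_simps)
  qed
  then obtain f where f: "linear f" "\<And>d. f d \<le> p d"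
    using hahn_banach_sublinear by blast
  have "f d \<le> r" if "(d, r) \<in> C" for d r
  proof -
    have "r \<in> R d"
      unfolding R_def using that by (intro CollectI exI[of _ r] exI[of _ 1]) auto
    then have "p d \<le> r"
      unfolding p_def using bdd by (rule cInf_lower)
    with f(2) show ?thesis by (rule order_trans)
  qed
  with f(1) show ?thesis by (rule that)
qed

lemma continuous_on_scaleR_left_lcs:
  fixes d :: "'a::locally_convex_space"
  shows "continuous_on UNIV (\<lambda>t. t *\<^sub>R d)"
proof -
  have "((\<lambda>t. t *\<^sub>R d) \<longlongrightarrow> a *\<^sub>R d) (at a)" for a
    using filterlim_compose[OF tendsto_scaleR_Pair filterlim_Pair[OF tendsto_ident_at tendsto_const]]
    by simp
  then show ?thesis
    by (simp add: continuous_on_def)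
qed

lemma continuous_on_scaleR_right_lcs:
  "continuous_on UNIV (\<lambda>x :: 'a::locally_convex_space. c *\<^sub>R x)"
proof -
  have "((\<lambda>x. c *\<^sub>R x) \<longlongrightarrow> c *\<^sub>R a) (at a)" for a :: 'a
    using filterlim_compose[OF tendsto_scaleR_Pair filterlim_Pair[OF tendsto_const tendsto_ident_at]]
    by simp
  then show ?thesis
    by (simp add: continuous_on_def)
qed

lemma open_absorbing:
  fixes N :: "'a::locally_convex_space set"
  assumes "open N" "0 \<in> N"
  obtains t where "0 < t" "t *\<^sub>R d \<in> N"
proof -
  have "open ((\<lambda>t. t *\<^sub>R d) -` N)"
    using assms(1) continuous_on_scaleR_left_lcs by (rule open_vimage)
  moreover have "0 \<in> (\<lambda>t. t *\<^sub>R d) -` N"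
    using assms(2) by simp
  ultimately obtain e where e: "0 < e" "\<And>t. dist t 0 < e \<Longrightarrow> t *\<^sub>R d \<in> N"
    unfolding open_dist by (metis vimage_eq)
  then show ?thesis
    using that[of "e / 2"] by (auto simp: dist_real_def)
qed

text \<open>Applying the bound at a large multiple of \<open>x\<close> and at its negative makes the
  modulus of \<open>f x\<close> small, which is continuity at 0; translation gives the rest.\<close>

lemma continuous_on_linear_bounded_above:
  fixes f :: "'a::locally_convex_space \<Rightarrow> real"
  assumes lin: "linear f" and N: "open N" "0 \<in> N" and le: "\<And>x. x \<in> N \<Longrightarrow> f x \<le> M"
  shows "continuous_on UNIV f"
proof -
  have f0: "(f \<longlongrightarrow> 0) (nhds 0)"
  proof (rule tendstoI)
    fix e :: real assume e: "0 < e"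
    \<comment> \<open>With this \<open>c\<close> the bound \<open>M\<close> is strictly below
      \<open>c * e\<close>; the summand 1 keeps \<open>c\<close> positive when
      \<open>M = 0\<close>.\<close>
    define c where "c = (\<bar>M\<bar> + 1) / e"
    have c: "0 < c" using e by (simp add: c_def)
    let ?U = "(\<lambda>x. c *\<^sub>R x) -` N \<inter> (\<lambda>x. (- c) *\<^sub>R x) -` N"
    have "open ?U"
      using N(1) continuous_on_scaleR_right_lcs by (intro open_Int open_vimage)
    moreover have "dist (f x) 0 < e" if "x \<in> ?U" for x
    proof -
      have "c * f x \<le> M" "- c * f x \<le> M"
        using le[of "c *\<^sub>R x"] le[of "(- c) *\<^sub>R x"] that
        by (auto simp: linear_scale[OF lin] linear_neg[OF lin])
      then have "c * \<bar>f x\<bar> < c * e"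
        using c e by (simp add: c_def abs_if split: if_splits)
      then show ?thesis
        using c by (simp add: dist_real_def)
    qed
    moreover have "0 \<in> ?U" using N(2) by simp
    ultimately show "\<forall>\<^sub>F x in nhds 0. dist (f x) 0 < e"
      unfolding eventually_nhds by blast
  qed
  have "(f \<longlongrightarrow> f a) (at a)" for a
  proof -
    have "((\<lambda>x. x - a) \<longlongrightarrow> a - a) (at a)"
      by (intro tendsto_diff tendsto_ident_at tendsto_const)
    then have "((\<lambda>x. f (x - a) + f a) \<longlongrightarrow> 0 + f a) (at a)"
      by (intro tendsto_add filterlim_compose[OF f0] tendsto_const) simp
    then show ?thesis
      by (simp add: linear_diff[OF lin])
  qed
  then show ?thesis
    by (simp add: continuous_on_def)
qed

text \<open>Since \<open>A\<close> lies above \<open>B\<close>, every point of the difference set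
  over 0 has nonnegative height, so a linear functional fits below that set. The bound over
  \<open>N\<close> supplies absorption and also bounds \<open>f\<close> above on \<open>N\<close>,
  whence continuity.\<close>

lemma convex_sandwich:
  fixes A B :: "('a::locally_convex_space \<times> real) set"
  assumes "convex A" "convex B" and le: "\<And>x s t. (x, s) \<in> A \<Longrightarrow> (x, t) \<in> B \<Longrightarrow> t \<le> s"
    and N: "open N" "0 \<in> N"
    and bound: "\<And>d. d \<in> N \<Longrightarrow> \<exists>x y s t. (x, s) \<in> A \<and> (y, t) \<in> B \<and> x - y = d \<and> s - t \<le> M"
  obtains f where "linear f" "continuous_on UNIV f"
    "\<And>x s y t. (x, s) \<in> A \<Longrightarrow> (y, t) \<in> B \<Longrightarrow> f (x - y) \<le> s - t"
proof -
  let ?C = "\<Union>a\<in>A. \<Union>b\<in>B. {a - b}"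
  have inC: "(x - y, s - t) \<in> ?C" if "(x, s) \<in> A" "(y, t) \<in> B" for x s y t
    using that by force
  have "convex ?C"
    using assms(1,2) by (rule convex_differences)
  moreover have "0 \<le> r" if "(0, r) \<in> ?C" for r
    using that le by (fastforce simp: prod_eq_iff)
  moreover have "\<exists>t>0. \<exists>r. (t *\<^sub>R d, r) \<in> ?C" for d
  proof -
    obtain t where t: "0 < t" "t *\<^sub>R d \<in> N"
      using N by (rule open_absorbing)
    show ?thesis
      using bound[OF t(2)] t(1) inC by metis
  qed
  ultimately obtain f where f: "linear f" "\<And>d r. (d, r) \<in> ?C \<Longrightarrow> f d \<le> r"
    using linear_below_convex[of ?C] by blast
  then have sep: "f (x - y) \<le> s - t" if "(x, s) \<in> A" "(y, t) \<in> B" for x s y t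
    using inC[OF that] by blast
  have "f d \<le> M" if "d \<in> N" for d
    using bound[OF that] sep by fastforce
  then have "continuous_on UNIV f"
    by (rule continuous_on_linear_bounded_above[OF f(1) N])
  with f(1) show ?thesis
    using sep by (rule that)
qed

section \<open>Convexity of the shifted epigraph and of the obstacle penalty\<close>

text \<open>The shift \<open>c\<close> is later the minimum of \<open>E\<close> on the interval,
  which puts the minimizer at height 0.\<close>

lemma convex_epigraph_functional:
  assumes E: "convex_functional E"
  shows "convex {(x, s). E x \<le> ereal (c + s)}"
proof (rule convexI, clarsimp)
  fix x y :: 'a and s t u v :: real
  assume le: "E x \<le> ereal (c + s)" "E y \<le> ereal (c + t)" and uv: "0 \<le> u" "0 \<le> v" "u + v = 1"
  have "E (u *\<^sub>R x + v *\<^sub>R y) \<le> ereal u * E x + ereal v * E y"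
    using E uv by (auto simp: convex_functional_def)
  also have "\<dots> \<le> ereal u * ereal (c + s) + ereal v * ereal (c + t)"
    using le uv by (intro add_mono ereal_mult_left_mono) auto
  also have "\<dots> = ereal ((u + v) * c + (u * s + v * t))"
    by (simp add: algebra_simps)
  finally show "E (u *\<^sub>R x + v *\<^sub>R y) \<le> ereal (c + (u * s + v * t))"
    using uv by simp
qed

text \<open>The witness is \<open>inf z a\<close>: both \<open>z\<close> and \<open>a\<close>
  dominate \<open>z - b\<close>, so the remainder \<open>z - inf z a\<close> is at most
  \<open>b\<close>.\<close>

lemma riesz_decomposition:
  fixes z a b :: "'a::lattice_ab_group_add"
  assumes "0 \<le> z" "z \<le> a + b" "0 \<le> a" "0 \<le> b"
  obtains x y where "z = x + y" "x \<in> {0..a}" "y \<in> {0..b}"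
proof
  show "z = inf z a + (z - inf z a)"
    by (metis add.commute diff_add_cancel)
  show "inf z a \<in> {0..a}" using assms by simp
  have "z - b \<le> inf z a"
    using assms by (simp add: diff_le_eq)
  then show "z - inf z a \<in> {0..b}"
    by (metis add.commute atLeastAtMost_iff diff_ge_0_iff_ge diff_le_eq inf_le1)
qed

text \<open>Scaling by \<open>inverse u\<close> maps the interval into \<open>{0..p}\<close>; for
  \<open>u = 0\<close> it consists of 0 alone.\<close>

lemma upper_bound_scaleR_interval:
  fixes w :: "'a::topological_vector_lattice \<Rightarrow> real"
  assumes w: "linear w" and ub: "\<And>z. z \<in> {0..p} \<Longrightarrow> w z \<le> c" and u: "0 \<le> u" and z: "z \<in> {0..u *\<^sub>R p}"
  shows "w z \<le> u * c"
proof (cases "u = 0")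
  case True
  with z show ?thesis by (simp add: linear_0[OF w])
next
  case False
  with u have "0 < u" by simp
  with z have "inverse u *\<^sub>R z \<in> {0..p}"
    using scaleR_left_mono[of z "u *\<^sub>R p" "inverse u"] by (auto intro: scaleR_nonneg_nonneg)
  from ub[OF this] show ?thesis
    using \<open>0 < u\<close> by (simp add: linear_scale[OF w] field_simps)
qed

text \<open>At \<open>y \<le> \<psi>\<close>, the least \<open>- t\<close> in the following set is the Riesz--Kantorovich supremum of \<open>w\<close> and
  \<open>0\<close> at \<open>pprt (\<phi> - y)\<close>; allowing all \<open>p \<ge> pprt (\<phi> - y)\<close> makes convexity immediate.\<close>

definition obstacle_penalty ::
  "('a::topological_vector_lattice \<Rightarrow> real) \<Rightarrow> 'a \<Rightarrow> 'a \<Rightarrow> ('a \<times> real) set" where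
  "obstacle_penalty w \<phi> \<psi> =
    {(y, t). y \<le> \<psi> \<and> (\<exists>p\<ge>0. \<phi> - y \<le> p \<and> (\<forall>z\<in>{0..p}. w z \<le> - t))}"

text \<open>If \<open>p\<close> and \<open>q\<close> are admissible at the two points, their
  combination is admissible at the combined point: the Riesz decomposition splits each
  \<open>z\<close> below it into parts on which the two given bounds, scaled by \<open>u\<close> and
  \<open>v\<close>, apply.\<close>

lemma convex_obstacle_penalty:
  assumes w: "linear w"
  shows "convex (obstacle_penalty w \<phi> \<psi>)"
proof (rule convexI)
  fix b c :: "'a \<times> real" and u v :: real
  assume bc: "b \<in> obstacle_penalty w \<phi> \<psi>" "c \<in> obstacle_penalty w \<phi> \<psi>"
    and uv: "0 \<le> u" "0 \<le> v" "u + v = 1"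
  obtain x s p where b: "b = (x, s)" and x: "x \<le> \<psi>"
    and p: "0 \<le> p" "\<phi> - x \<le> p" "\<forall>z\<in>{0..p}. w z \<le> - s"
    using bc(1) unfolding obstacle_penalty_def by blast
  obtain y t q where c: "c = (y, t)" and y: "y \<le> \<psi>"
    and q: "0 \<le> q" "\<phi> - y \<le> q" "\<forall>z\<in>{0..q}. w z \<le> - t"
    using bc(2) unfolding obstacle_penalty_def by blast
  have comb: "u *\<^sub>R a + v *\<^sub>R a = a" for a :: 'a
    using uv by (simp flip: scaleR_add_left)
  have up: "0 \<le> u *\<^sub>R p" "0 \<le> v *\<^sub>R q"
    using uv p q by (auto intro: scaleR_nonneg_nonneg)
  have "u *\<^sub>R x + v *\<^sub>R y \<le> u *\<^sub>R \<psi> + v *\<^sub>R \<psi>"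
    using x y uv by (intro add_mono scaleR_left_mono)
  moreover have "u *\<^sub>R (\<phi> - x) + v *\<^sub>R (\<phi> - y) \<le> u *\<^sub>R p + v *\<^sub>R q"
    using p q uv by (intro add_mono scaleR_left_mono)
  then have "\<phi> - (u *\<^sub>R x + v *\<^sub>R y) \<le> u *\<^sub>R p + v *\<^sub>R q"
    using comb[of \<phi>] by (simp add: algebra_simps)
  moreover have "w z \<le> - (u * s + v * t)" if z: "z \<in> {0..u *\<^sub>R p + v *\<^sub>R q}" for z
  proof -
    obtain a b where ab: "z = a + b" "a \<in> {0..u *\<^sub>R p}" "b \<in> {0..v *\<^sub>R q}"
      using riesz_decomposition[of z "u *\<^sub>R p" "v *\<^sub>R q"] z up by auto
    have "w a \<le> u * - s" "w b \<le> v * - t"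
      using upper_bound_scaleR_interval[OF w _ uv(1) ab(2)] p(3)
        upper_bound_scaleR_interval[OF w _ uv(2) ab(3)] q(3) by blast+
    then show ?thesis
      using ab(1) by (simp add: linear_add[OF w])
  qed
  moreover have "0 \<le> u *\<^sub>R p + v *\<^sub>R q"
    using up by (rule add_nonneg_nonneg)
  ultimately have "(u *\<^sub>R x + v *\<^sub>R y, u * s + v * t) \<in> obstacle_penalty w \<phi> \<psi>"
    unfolding obstacle_penalty_def comb[of \<psi>] by blast
  then show "u *\<^sub>R b + v *\<^sub>R c \<in> obstacle_penalty w \<phi> \<psi>"
    by (simp add: b c)
qed

section \<open>From the penalty to a subgradient at the minimizer\<close>

text \<open>The subgradient inequality at \<open>inf y \<phi>\<close> gives
  \<open>E \<phi> + t\<close> as a lower bound of \<open>E (inf y \<phi>)\<close>. Adding the bound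
  \<open>m\<close> at \<open>sup y \<phi>\<close>, submodularity leaves \<open>t \<le> s\<close>
  once the finite value \<open>E \<phi>\<close> cancels.\<close>

lemma obstacle_penalty_estimate:
  fixes E :: "'a::topological_vector_lattice \<Rightarrow> ereal"
  assumes noninf: "\<And>x. E x \<noteq> - \<infinity>" and E: "submodular E" and "\<phi> \<le> \<psi>"
    and min: "\<And>x. x \<in> {\<phi>..\<psi>} \<Longrightarrow> ereal m \<le> E x"
    and w: "w \<in> subdifferential E \<phi>"
    and t: "(y, t) \<in> obstacle_penalty w \<phi> \<psi>" and s: "E y \<le> ereal (m + s)"
  shows "t \<le> s"
proof -
  have lin: "linear w"
    using w by (simp add: subdifferential_def topological_dual_def)
  obtain e where e: "E \<phi> = ereal e"
    using w noninf[of \<phi>] by (cases "E \<phi>") (auto simp: subdifferential_def effective_domain_def)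
  obtain p where y: "y \<le> \<psi>" and p: "0 \<le> p" "\<phi> - y \<le> p" "\<And>z. z \<in> {0..p} \<Longrightarrow> w z \<le> - t"
    using t by (auto simp: obstacle_penalty_def)
  have "\<phi> \<le> y + p"
    using p(2) by (simp add: algebra_simps)
  then have "\<phi> - p \<le> inf y \<phi>"
    using p(1) by (simp add: diff_le_eq add.commute)
  \<comment> \<open>This element is \<open>pprt (\<phi> - y)\<close>, the least \<open>p\<close>
    allowed in the penalty.\<close>
  then have "\<phi> - inf y \<phi> \<in> {0..p}"
    by (metis add.commute atLeastAtMost_iff diff_ge_0_iff_ge diff_le_eq inf_le2)
  from p(3)[OF this] have wz: "w \<phi> - w (inf y \<phi>) \<le> - t"
    unfolding linear_diff[OF lin] .
  have "ereal (w (inf y \<phi> - \<phi>)) \<le> E (inf y \<phi>) - E \<phi>"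
    using w by (simp add: subdifferential_def)
  then have 1: "ereal (e - (w \<phi> - w (inf y \<phi>))) \<le> E (inf y \<phi>)"
    using e by (cases "E (inf y \<phi>)") (auto simp: linear_diff[OF lin])
  \<comment> \<open>The constraint \<open>y \<le> \<psi>\<close> built into the penalty set keeps
    the supremum inside the interval.\<close>
  have 2: "ereal m \<le> E (sup y \<phi>)"
    using y assms(3) by (intro min) auto
  have "ereal (e - (w \<phi> - w (inf y \<phi>))) + ereal m \<le> E (inf y \<phi>) + E (sup y \<phi>)"
    using 1 2 by (rule add_mono)
  also have "\<dots> \<le> E y + E \<phi>"
    using E by (simp add: submodular_def)
  also have "\<dots> \<le> ereal (m + s) + ereal e"
    using s e by (intro add_mono) auto
  finally show ?thesis
    using wz by simp
qed

text \<open>The epigraph and the penalty set meet at \<open>(ubar, 0)\<close>. Fixing that point in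
  the penalty set turns the separation into the subgradient inequality; fixing it in the epigraph
  gives the bound by \<open>c\<close>.\<close>

lemma subgradient_at_minimizer:
  fixes E :: "'a::topological_vector_lattice \<Rightarrow> ereal"
  assumes noninf: "\<And>x. E x \<noteq> - \<infinity>" and conv: "convex_functional E" and sub: "submodular E"
    and "\<phi> \<le> \<psi>"
    and ubar: "ubar \<in> {\<phi>..\<psi>}" and min: "\<And>x. x \<in> {\<phi>..\<psi>} \<Longrightarrow> E ubar \<le> E x"
    and N: "open N" "0 \<in> N"
    and qual: "\<And>d. d \<in> N \<Longrightarrow> \<exists>x y. E x \<le> ereal M \<and> y \<in> {\<phi>..\<psi>} \<and> x - y = d"
    and w: "w \<in> subdifferential E \<phi>"
  obtains f where "f \<in> subdifferential E ubar"
    "\<And>v c. 0 \<le> v \<Longrightarrow> (\<And>z. z \<in> {0..v} \<Longrightarrow> w z \<le> c) \<Longrightarrow> f v \<le> c"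
proof -
  have lin: "linear w"
    using w by (simp add: subdifferential_def topological_dual_def)
  \<comment> \<open>Taking \<open>d = 0\<close> forces \<open>x = y\<close>, a point of the interval
    with energy at most \<open>M\<close>; hence \<open>E ubar\<close> is finite.\<close>
  obtain x where "E x \<le> ereal M" "x \<in> {\<phi>..\<psi>}"
    using qual[OF N(2)] by auto
  then have "E ubar \<le> ereal M"
    using min order_trans by blast
  then obtain m where m: "E ubar = ereal m"
    using noninf[of ubar] by (cases "E ubar") auto
  let ?A = "{(x, s). E x \<le> ereal (m + s)}"
  let ?B = "obstacle_penalty w \<phi> \<psi>"
  \<comment> \<open>On the interval \<open>p = 0\<close> is admissible, and \<open>w\<close>
    vanishes on \<open>{0..0}\<close>.\<close>
  have zero: "(y, 0) \<in> ?B" if "y \<in> {\<phi>..\<psi>}" for y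
    using that by (auto simp: obstacle_penalty_def linear_0[OF lin] intro!: exI[of _ 0])
  obtain f where f: "linear f" "continuous_on UNIV f"
    and sep: "\<And>x s y t. (x, s) \<in> ?A \<Longrightarrow> (y, t) \<in> ?B \<Longrightarrow> f (x - y) \<le> s - t"
  proof (rule convex_sandwich[of ?A ?B N "M - m"])
    show "convex ?A" using conv by (rule convex_epigraph_functional)
    show "convex ?B" using lin by (rule convex_obstacle_penalty)
    show "t \<le> s" if "(x, s) \<in> ?A" "(x, t) \<in> ?B" for x s t
    proof (rule obstacle_penalty_estimate[OF noninf sub assms(4) _ w that(2)])
      show "E x \<le> ereal (m + s)"
        using that(1) by simp
    qed (use min m in simp)
    show "\<exists>x y s t. (x, s) \<in> ?A \<and> (y, t) \<in> ?B \<and> x - y = d \<and> s - t \<le> M - m" if "d \<in> N" for d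
    proof -
      obtain x y where "E x \<le> ereal M" "y \<in> {\<phi>..\<psi>}" "x - y = d"
        using qual[OF \<open>d \<in> N\<close>] by blast
      then show ?thesis
        using zero by (intro exI[of _ x] exI[of _ y] exI[of _ "M - m"] exI[of _ 0]) simp
    qed
  qed (use N in auto)
  show ?thesis
  proof
    have "ereal (f (x - ubar)) \<le> E x - E ubar" for x
    proof (cases "E x")
      case (real r)
      with sep[OF _ zero[OF ubar], of x "r - m"] m show ?thesis by simp
    qed (use noninf m in auto)
    with f m show "f \<in> subdifferential E ubar"
      by (auto simp: subdifferential_def topological_dual_def effective_domain_def)
  next
    fix v c assume v: "0 \<le> v" and c: "\<And>z. z \<in> {0..v} \<Longrightarrow> w z \<le> c"
    have "ubar - v \<le> \<psi>"
      using v ubar by (auto simp: diff_le_eq add_increasing2)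
    \<comment> \<open>Because \<open>\<phi> \<le> ubar\<close>, the vector \<open>v\<close> itself
      is an admissible \<open>p\<close> at \<open>ubar - v\<close>.\<close>
    moreover have "\<phi> - (ubar - v) \<le> v"
      using ubar by (simp add: algebra_simps)
    ultimately have "(ubar - v, - c) \<in> ?B"
      using v c by (auto simp: obstacle_penalty_def)
    with sep[of ubar 0] m show "f v \<le> c" by fastforce
  qed
qed

section \<open>The lattice dual and the reflection in the origin\<close>

text \<open>Write \<open>w\<close> as \<open>g - h\<close> with both positive. Then
  \<open>g v\<close> bounds \<open>w\<close> on \<open>{0..v}\<close>, so \<open>f\<close> lies
  below \<open>g\<close> on the cone and is the difference of \<open>g\<close> and the positive
  functional \<open>g - f\<close>.\<close>

lemma subgradient_in_lattice_dual:
  assumes "f \<in> topological_dual" "w \<in> lattice_dual"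
    and le: "\<And>v c. 0 \<le> v \<Longrightarrow> (\<And>z. z \<in> {0..v} \<Longrightarrow> w z \<le> c) \<Longrightarrow> f v \<le> c"
  shows "f \<in> lattice_dual"
proof -
  obtain g h where w: "w = (\<lambda>z. g z - h z)" and gh: "g \<in> positive_dual" "h \<in> positive_dual"
    using assms(2) by (auto simp: lattice_dual_def)
  have g: "linear g" and pos: "\<And>y. 0 \<le> y \<Longrightarrow> 0 \<le> g y" "\<And>y. 0 \<le> y \<Longrightarrow> 0 \<le> h y"
    using gh by (auto simp: positive_dual_def topological_dual_def positive_cone_def)
  have "f v \<le> g v" if v: "0 \<le> v" for v
  proof (rule le[OF v])
    fix z assume z: "z \<in> {0..v}"
    then show "w z \<le> g v"
      using pos(1)[of "v - z"] pos(2)[of z] by (simp add: w linear_diff[OF g])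
  qed
  then have "(\<lambda>x. g x - f x) \<in> positive_dual"
    using assms(1) gh(1)
    by (auto simp: positive_dual_def topological_dual_def positive_cone_def
        intro: linear_compose_sub continuous_on_diff)
  then show ?thesis
    using gh(1) unfolding lattice_dual_def
    by (intro CollectI exI[of _ g] exI[of _ "\<lambda>x. g x - f x"]) simp
qed

lemma zero_in_lattice_dual: "(\<lambda>_. 0) \<in> lattice_dual"
proof -
  have "(\<lambda>_. 0) \<in> positive_dual"
    by (simp add: positive_dual_def topological_dual_def linear_zero)
  then show ?thesis
    unfolding lattice_dual_def by force
qed

lemma uminus_in_lattice_dual:
  assumes "f \<in> lattice_dual"
  shows "(\<lambda>x. - f x) \<in> lattice_dual"
proof -
  obtain g h where "f = (\<lambda>x. g x - h x)" "g \<in> positive_dual" "h \<in> positive_dual"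
    using assms by (auto simp: lattice_dual_def)
  moreover from this have "(\<lambda>x. - f x) = (\<lambda>x. h x - g x)" by auto
  ultimately show ?thesis
    unfolding lattice_dual_def by blast
qed

lemma topological_dual_uminus:
  "f \<in> topological_dual \<Longrightarrow> (\<lambda>x. - f x) \<in> topological_dual"
  by (auto simp: topological_dual_def intro: linear_compose_neg continuous_on_minus)

text \<open>This serves in both directions: to pass to the reflected problem and to bring its
  subgradient back.\<close>

lemma subdifferential_reflect:
  assumes "f \<in> subdifferential E a"
  shows "(\<lambda>x. - f x) \<in> subdifferential (\<lambda>x. E (- x)) (- a)"
proof -
  have f: "f \<in> topological_dual" "\<And>x. ereal (f (x - a)) \<le> E x - E a" "a \<in> effective_domain E"
    using assms by (auto simp: subdifferential_def)
  then have lin: "linear f"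
    by (simp add: topological_dual_def)
  have "- f (x + a) = f (- x - a)" for x
    using linear_neg[OF lin, of "x + a"] by simp
  then show ?thesis
    using f(2)[of "- x" for x] f(1,3)
    by (simp add: subdifferential_def topological_dual_uminus effective_domain_def)
qed

lemma convex_functional_reflect:
  assumes "convex_functional E"
  shows "convex_functional (\<lambda>x. E (- x))"
  unfolding convex_functional_def
proof (intro allI impI)
  fix x y and u v :: real
  assume "0 \<le> u" "0 \<le> v" "u + v = 1"
  then have "E (u *\<^sub>R (- x) + v *\<^sub>R (- y)) \<le> ereal u * E (- x) + ereal v * E (- y)"
    using assms unfolding convex_functional_def by blast
  then show "E (- (u *\<^sub>R x + v *\<^sub>R y)) \<le> ereal u * E (- x) + ereal v * E (- y)"
    by simp
qed

lemma submodular_reflect: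
  fixes E :: "'a::topological_vector_lattice \<Rightarrow> ereal"
  assumes "submodular E"
  shows "submodular (\<lambda>x. E (- x))"
proof -
  have "E (sup (- x) (- y)) + E (inf (- x) (- y)) \<le> E (- x) + E (- y)" for x y
    using assms unfolding submodular_def by (simp add: add.commute)
  then show ?thesis
    by (simp add: submodular_def neg_inf_eq_sup neg_sup_eq_inf)
qed

section \<open>The qualification condition and the two obstacles\<close>

text \<open>Both alternatives let differences of a sublevel set of \<open>E\<close> and
  \<open>I\<close> cover a neighbourhood of 0. In the first, \<open>x\<close> stays at a point of
  the domain and \<open>y\<close> moves inside \<open>I\<close>; in the second, \<open>y\<close>
  stays and continuity lets \<open>x\<close> move with \<open>E x\<close> below
  \<open>M\<close>.\<close>

lemma constraint_qualification:
  fixes E :: "'a::topological_vector_lattice \<Rightarrow> ereal"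
  assumes noninf: "\<And>x. E x \<noteq> - \<infinity>"
    and "effective_domain E \<inter> interior I \<noteq> {} \<or> (\<exists>u \<in> effective_domain E \<inter> I. isCont E u)"
  obtains N M where "open N" "0 \<in> N" "\<And>d. d \<in> N \<Longrightarrow> \<exists>x y. E x \<le> ereal M \<and> y \<in> I \<and> x - y = d"
  using assms(2)
proof
  assume "effective_domain E \<inter> interior I \<noteq> {}"
  then obtain z where z: "E z < \<infinity>" "z \<in> interior I"
    by (auto simp: effective_domain_def)
  then obtain M where M: "E z = ereal M"
    using noninf[of z] by (cases "E z") auto
  show ?thesis
  proof
    show "open ((\<lambda>d. z - d) -` interior I)"
      by (intro open_vimage continuous_intros) auto
    show "\<exists>x y. E x \<le> ereal M \<and> y \<in> I \<and> x - y = d" if "d \<in> (\<lambda>d. z - d) -` interior I" for d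
      using that interior_subset[of I] M by (intro exI[of _ z] exI[of _ "z - d"]) auto
  qed (use z in auto)
next
  assume "\<exists>u \<in> effective_domain E \<inter> I. isCont E u"
  then obtain u where u: "E u < \<infinity>" "u \<in> I" and cont: "isCont E u"
    by (auto simp: effective_domain_def)
  obtain M where M: "E u < ereal M"
    using ereal_dense2[OF u(1)] by auto
  have "(E \<longlongrightarrow> E u) (nhds u)"
    using cont by (simp add: isCont_def tendsto_at_iff_tendsto_nhds)
  then have "\<forall>\<^sub>F x in nhds u. E x < ereal M"
    using M by (rule order_tendstoD)
  then obtain S where S: "open S" "u \<in> S" "\<And>x. x \<in> S \<Longrightarrow> E x < ereal M"
    unfolding eventually_nhds by blast
  show ?thesis
  proof
    show "open ((\<lambda>d. u + d) -` S)"
      using S(1) by (intro open_vimage continuous_intros) auto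
    show "\<exists>x y. E x \<le> ereal M \<and> y \<in> I \<and> x - y = d" if "d \<in> (\<lambda>d. u + d) -` S" for d
      using that S(3)[of "u + d"] u(2) by (intro exI[of _ "u + d"] exI[of _ u]) auto
  qed (use S in auto)
qed

theorem theorem2p4:
  fixes E :: "'b::topological_vector_lattice \<Rightarrow> ereal"
    and \<phi> \<psi> ubar :: 'b
  assumes "\<And>x. E x \<noteq> -\<infinity>"
    and "convex_functional E"
    and "submodular E"
    and "\<phi> \<le> \<psi>"
    and "is_arg_min E (\<lambda>z. z \<in> {\<phi>..\<psi>}) ubar"
    and "effective_domain E \<inter> interior {\<phi>..\<psi>} \<noteq> {} \<or>
      (\<exists>u \<in> effective_domain E \<inter> {\<phi>..\<psi>}. isCont E u)"
  shows "(\<forall>w1 \<in> subdifferential E \<phi> \<inter> lattice_dual.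
            \<exists>x1 \<in> subdifferential E ubar \<inter> lattice_dual. dual_le x1 (dual_sup w1 (\<lambda>_. 0))) \<and>
         (\<forall>w2 \<in> subdifferential E \<psi> \<inter> lattice_dual.
            \<exists>x2 \<in> subdifferential E ubar \<inter> lattice_dual. dual_le (dual_inf w2 (\<lambda>_. 0)) x2)"
proof -
  have min: "E ubar \<le> E x" if "x \<in> {\<phi>..\<psi>}" for x
    using assms(5) that by (auto simp: is_arg_min_def not_less)
  have ubar: "ubar \<in> {\<phi>..\<psi>}"
    using assms(5) by (simp add: is_arg_min_def)
  obtain N M where N: "open N" "0 \<in> N"
    and qual: "\<And>d. d \<in> N \<Longrightarrow> \<exists>x y. E x \<le> ereal M \<and> y \<in> {\<phi>..\<psi>} \<and> x - y = d"
    using constraint_qualification[OF assms(1,6)] by blast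
  have in_dual: "f \<in> topological_dual" if "f \<in> subdifferential G x" for f x and G :: "'b \<Rightarrow> ereal"
    using that by (simp add: subdifferential_def)
  have linear_dual: "linear f" if "f \<in> topological_dual" for f :: "'b \<Rightarrow> real"
    using that by (simp add: topological_dual_def)
  show ?thesis
  proof (intro conjI ballI; elim IntE)
    fix w assume w: "w \<in> subdifferential E \<phi>" "w \<in> lattice_dual"
    obtain f where f: "f \<in> subdifferential E ubar"
      and le: "\<And>v c. 0 \<le> v \<Longrightarrow> (\<And>z. z \<in> {0..v} \<Longrightarrow> w z \<le> c) \<Longrightarrow> f v \<le> c"
      using subgradient_at_minimizer[OF assms(1-4) ubar min N qual w(1)] by blast
    have "f \<in> lattice_dual"
      using in_dual[OF f] w(2) le by (rule subgradient_in_lattice_dual)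
    moreover have "f v \<le> dual_sup w (\<lambda>_. 0) v" if v: "v \<in> positive_cone" for v
    proof -
      \<comment> \<open>Boundedness makes the real \<open>SUP\<close> an upper bound of
        \<open>w\<close> on \<open>{0..v}\<close>, so it may serve as \<open>c\<close>.\<close>
      have "bdd_above (w ` {0..v})"
        using lattice_dual_bdd(1)[OF w(2) zero_in_lattice_dual, of v] by simp
      then have "f v \<le> (SUP z\<in>{0..v}. w z)"
        using v by (intro le cSUP_upper) (auto simp: positive_cone_def)
      then show ?thesis
        using v in_dual[OF w(1)] by (simp add: dual_sup_on_cone linear_dual linear_zero)
    qed
    ultimately show "\<exists>x1 \<in> subdifferential E ubar \<inter> lattice_dual. dual_le x1 (dual_sup w (\<lambda>_. 0))"
      using f by (intro bexI[of _ f]) (auto simp: dual_le_def)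
  next
    fix w assume w: "w \<in> subdifferential E \<psi>" "w \<in> lattice_dual"
    \<comment> \<open>Under reflection the upper obstacle \<psi> becomes the lower obstacle
      \<open>- \<psi>\<close>, with \<open>?w\<close> a subgradient of \<open>?E\<close> there, so
      the same separation applies.\<close>
    let ?E = "\<lambda>x. E (- x)" and ?w = "\<lambda>x. - w x" and ?N = "uminus -` N"
    have refl: "- x \<in> {- \<psi>..- \<phi>} \<longleftrightarrow> x \<in> {\<phi>..\<psi>}" "x \<in> {- \<psi>..- \<phi>} \<longleftrightarrow> - x \<in> {\<phi>..\<psi>}" for x
      by (auto simp: minus_le_iff le_minus_iff)
    obtain f where f: "f \<in> subdifferential ?E (- ubar)"
      and le: "\<And>v c. 0 \<le> v \<Longrightarrow> (\<And>z. z \<in> {0..v} \<Longrightarrow> - w z \<le> c) \<Longrightarrow> f v \<le> c"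
    proof (rule subgradient_at_minimizer[of ?E "- \<psi>" "- \<phi>" "- ubar" ?N M ?w])
      show "convex_functional ?E"
        using assms(2) by (rule convex_functional_reflect)
      show "submodular ?E"
        using assms(3) by (rule submodular_reflect)
      show "open ?N"
        using N(1) by (intro open_vimage continuous_intros)
      show "\<exists>x y. ?E x \<le> ereal M \<and> y \<in> {- \<psi>..- \<phi>} \<and> x - y = d" if d: "d \<in> ?N" for d
      proof -
        obtain x y where xy: "E x \<le> ereal M" "y \<in> {\<phi>..\<psi>}" "x - y = - d"
          using qual[of "- d"] d by auto
        then have "- x - - y = d"
          by (metis minus_diff_minus minus_minus)
        with xy refl(1)[of y] show ?thesis
          by (intro exI[of _ "- x"] exI[of _ "- y"]) simp
      qed
    qed (use assms(1,4) N(2) ubar min subdifferential_reflect[OF w(1)] in \<open>auto simp: refl simp del: atLeastAtMost_iff\<close>)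
    let ?f = "\<lambda>x. - f x"
    have f': "?f \<in> subdifferential E ubar"
      using subdifferential_reflect[OF f] by simp
    have "f \<in> lattice_dual"
      using in_dual[OF f] uminus_in_lattice_dual[OF w(2)] le by (rule subgradient_in_lattice_dual)
    then have "?f \<in> lattice_dual"
      by (rule uminus_in_lattice_dual)
    moreover have "dual_inf w (\<lambda>_. 0) v \<le> - f v" if v: "v \<in> positive_cone" for v
    proof -
      have bdd: "bdd_below (w ` {0..v})"
        using lattice_dual_bdd(2)[OF w(2) zero_in_lattice_dual, of v] by simp
      \<comment> \<open>The value taken for \<open>c\<close> is minus the infimum of
        \<open>w\<close>, an upper bound of \<open>- w\<close> on \<open>{0..v}\<close>.\<close>
      have "f v \<le> - (INF z\<in>{0..v}. w z)"
        using v by (intro le) (auto simp: positive_cone_def intro!: cINF_lower[OF bdd])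
      then show ?thesis
        using v in_dual[OF w(1)] by (simp add: dual_inf_on_cone linear_dual linear_zero)
    qed
    ultimately show "\<exists>x2 \<in> subdifferential E ubar \<inter> lattice_dual. dual_le (dual_inf w (\<lambda>_. 0)) x2"
      using f' by (intro bexI[of _ ?f]) (auto simp: dual_le_def)
  qed
qed

end
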